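(* Let $0<q<1$, let $m,n$ be nonnegative integers, let $f(x,y)$ be a function of two variables and $r,s>0$ such that all transforms involved converge. Then $$\mathcal{L}^{(2)}_{2,q}\big[x^my^nf(x,y)\big](r,s)=(-1)^{m+n}\frac{\partial_q^{m+n}}{\partial_qs^n\,\partial_qr^m}\mathcal{L}^{(2)}_{2,q}[f(x,y)](r,s).$$
   Context: Fix $0<q<1$. Notation: $[n]_q!=\prod_{k=1}^n\frac{1-q^k}{1-q}$, $[0]_q!=1$. The partial $q$-derivative is $\frac{\partial_qF}{\partial_qr}(r,s)=\frac{F(r,s)-F(qr,s)}{(1-q)r}$ for $r\ne0$, similarly in $s$, and higher $q$-derivatives are iterates. The small $q$-exponential is $e_q(z)=\sum_{n\ge0}\frac{z^n}{[n]_q!}$, extended meromorphically by $e_q(z)=\prod_{k\ge0}(1-(1-q)zq^k)^{-1}$. The improper Jackson $q$-integral is $\int_0^\infty f(x)\,d_qx=(1-q)\sum_{k\in\mathbb{Z}}q^kf(q^k)$, and double $q$-integrals are the corresponding (absolutely convergent) double series. The double $q$-Laplace transform of the second kind is $$\mathcal{L}^{(2)}_{2,q}[f(x,y)](r,s)=\int_0^\infty\!\!\int_0^\infty f(x,y)e_q(-rx)e_q(-sy)\,d_qx\,d_qy,\qquad r,s>0.$$ The transforms required to converge are that of $x^my^nf$ at $(r,s)$ and those of $f$ at the points $(q^ir,q^js)$, $0\le i\le m$, $0\le j\le n$. *)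

theory Defs
  imports "HOL-Analysis.Analysis"
begin

text \<open>
  Scalars range over a type \<open>'a\<close> of class \<open>{real_normed_field, banach}\<close>, so that both real-valued and
  complex-valued functions \<open>f\<close> are covered; \<open>q\<close> and the arguments \<open>x, y, r, s\<close> are real.
\<close>

definition qfact :: "real \<Rightarrow> nat \<Rightarrow> real" where
  "qfact q n = (\<Prod>k=1..n. (1 - q ^ k) / (1 - q))"

text \<open>
  The small q-exponential, defined by the infinite product that gives its meromorphic extension.
  Lemma \<open>qexp_eq_series\<close> below shows that it is the sum of the defining power series on the whole
  disc of convergence. At the poles the value is the irrelevant \<open>0\<close>; they all lie on the
  positive real axis, whereas the transform only uses negative real arguments.
\<close>

definition qexp :: "real \<Rightarrow> 'a \<Rightarrow> 'a::{real_normed_field, banach}" where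
  "qexp q z = (\<Prod>k. inverse (1 - of_real (1 - q) * z * of_real (q ^ k)))"

definition jackson_integrable2 :: "real \<Rightarrow> (real \<Rightarrow> real \<Rightarrow> 'a::{real_normed_field, banach}) \<Rightarrow> bool" where
  "jackson_integrable2 q F \<longleftrightarrow>
     (\<lambda>(j::int, k::int). of_real (q powi j * q powi k) * F (q powi j) (q powi k))
       abs_summable_on UNIV"

definition jackson_integral2 :: "real \<Rightarrow> (real \<Rightarrow> real \<Rightarrow> 'a) \<Rightarrow> 'a::{real_normed_field, banach}" where
  "jackson_integral2 q F =
     of_real ((1 - q)\<^sup>2) *
     (\<Sum>\<^sub>\<infinity>(j::int, k::int). of_real (q powi j * q powi k) * F (q powi j) (q powi k))"

definition qlaplace2_integrand ::
    "real \<Rightarrow> (real \<Rightarrow> real \<Rightarrow> 'a) \<Rightarrow> real \<Rightarrow> real \<Rightarrow> real \<Rightarrow> real \<Rightarrow> 'a::{real_normed_field, banach}" where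
  "qlaplace2_integrand q f r s x y =
     f x y * qexp q (of_real (- r * x)) * qexp q (of_real (- s * y))"

definition qlaplace2_converges ::
    "real \<Rightarrow> (real \<Rightarrow> real \<Rightarrow> 'a::{real_normed_field, banach}) \<Rightarrow> real \<Rightarrow> real \<Rightarrow> bool" where
  "qlaplace2_converges q f r s \<longleftrightarrow> jackson_integrable2 q (qlaplace2_integrand q f r s)"

definition qlaplace2 ::
    "real \<Rightarrow> (real \<Rightarrow> real \<Rightarrow> 'a) \<Rightarrow> real \<Rightarrow> real \<Rightarrow> 'a::{real_normed_field, banach}" where
  "qlaplace2 q f r s = jackson_integral2 q (qlaplace2_integrand q f r s)"

text \<open>Partial q-derivatives; only used at points whose relevant coordinate is nonzero.\<close>

definition qderiv_fst ::
    "real \<Rightarrow> (real \<Rightarrow> real \<Rightarrow> 'a) \<Rightarrow> real \<Rightarrow> real \<Rightarrow> 'a::{real_normed_field, banach}" where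
  "qderiv_fst q F r s = (F r s - F (q * r) s) / of_real ((1 - q) * r)"

definition qderiv_snd ::
    "real \<Rightarrow> (real \<Rightarrow> real \<Rightarrow> 'a) \<Rightarrow> real \<Rightarrow> real \<Rightarrow> 'a::{real_normed_field, banach}" where
  "qderiv_snd q F r s = (F r s - F r (q * s)) / of_real ((1 - q) * s)"

lemma qfact_Suc: "qfact q (Suc n) = qfact q n * ((1 - q ^ Suc n) / (1 - q))"
  unfolding qfact_def by simp

lemma qfact_pos:
  assumes "0 < q" "q < 1"
  shows "qfact q n > 0"
  unfolding qfact_def
  by (rule prod_pos) (use assms in \<open>auto intro!: divide_pos_pos simp: power_less_one_iff\<close>)

lemma qexp_series_summable:
  fixes z :: "'a::{real_normed_field, banach}"
  assumes q: "0 < q" "q < 1" and z: "norm z < 1 / (1 - q)"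
  shows "summable (\<lambda>n. of_real (1 / qfact q n) * z ^ n)"
proof -
  have lt: "(1 - q) * norm z < 1" using q z by (simp add: pos_less_divide_eq mult.commute[of "1 - q"])
  define c where "c = ((1 - q) * norm z + 1) / 2"
  have mid: "t < (t + 1) / 2" "(t + 1) / 2 < 1" if "t < 1" for t :: real
    using that by simp_all
  have c: "c < 1" and c': "(1 - q) * norm z < c"
    unfolding c_def using mid[OF lt] by blast+
  have "(\<lambda>n. q ^ Suc n) \<longlonglongrightarrow> 0"
    using q by (intro LIMSEQ_Suc LIMSEQ_power_zero) auto
  then have "(\<lambda>n. (1 - q) * norm z / (1 - q ^ Suc n)) \<longlonglongrightarrow> (1 - q) * norm z / (1 - 0)"
    by (intro tendsto_intros) auto
  then have "eventually (\<lambda>n. (1 - q) * norm z / (1 - q ^ Suc n) < c) sequentially"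
    using c' by (intro order_tendstoD(2)) auto
  then obtain N where N: "\<And>n. n \<ge> N \<Longrightarrow> (1 - q) * norm z / (1 - q ^ Suc n) < c"
    by (auto simp: eventually_sequentially)
  show ?thesis
  proof (rule summable_ratio_test[OF c])
    fix n assume "n \<ge> N"
    have p: "qfact q n > 0" by (rule qfact_pos[OF q])
    have d: "1 - q ^ Suc n > 0" using q by (simp add: power_Suc_less_one del: power_Suc)
    have "norm (of_real (1 / qfact q (Suc n)) * z ^ Suc n :: 'a)
        = ((1 - q) * norm z / (1 - q ^ Suc n)) * norm (of_real (1 / qfact q n) * z ^ n :: 'a)"
      unfolding norm_mult norm_of_real norm_power qfact_Suc
      using p d q by (simp add: abs_mult field_simps del: power_Suc) simp
    also have "\<dots> \<le> c * norm (of_real (1 / qfact q n) * z ^ n :: 'a)"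
      using N[OF \<open>n \<ge> N\<close>] by (intro mult_right_mono) auto
    finally show "norm (of_real (1 / qfact q (Suc n)) * z ^ Suc n :: 'a)
        \<le> c * norm (of_real (1 / qfact q n) * z ^ n :: 'a)" .
  qed
qed

lemma qexp_eq_series:
  fixes z :: "'a::{real_normed_field, banach}"
  assumes q: "0 < q" "q < 1" and z: "norm z < 1 / (1 - q)"
  shows "qexp q z = (\<Sum>n. z ^ n / of_real (qfact q n))"
proof -
  define a where "a n = (of_real (1 / qfact q n) :: 'a)" for n
  define G where "G w = (\<Sum>n. a n * w ^ n)" for w
  have summ: "summable (\<lambda>n. a n * w ^ n)" if "norm w < 1 / (1 - q)" for w
    unfolding a_def by (rule qexp_series_summable[OF q that])
  have small: "norm (z * of_real (q ^ n)) \<le> norm z" for n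
  proof -
    have "norm z * q ^ n \<le> norm z * 1"
      using q by (intro mult_left_mono power_le_one) auto
    then show ?thesis using q by (simp add: norm_mult norm_power)
  qed
  have step: "(1 - of_real (1 - q) * w) * G w = G (w * of_real q)"
    if w: "norm w < 1 / (1 - q)" for w
  proof -
    have "norm (w * of_real q) \<le> norm w"
      using q by (simp add: norm_mult mult_left_le)
    with w have w': "norm (w * of_real q) < 1 / (1 - q)" by linarith
    have "(\<lambda>n. a n * w ^ n - a n * (w * of_real q) ^ n) sums (G w - G (w * of_real q))"
      unfolding G_def by (intro sums_diff summable_sums summ w w')
    then have "(\<lambda>n. a (Suc n) * w ^ Suc n - a (Suc n) * (w * of_real q) ^ Suc n)
        sums (G w - G (w * of_real q))"
      by (subst sums_Suc_iff[of "\<lambda>n. a n * w ^ n - a n * (w * of_real q) ^ n"]) simp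
    moreover have "a (Suc n) * w ^ Suc n - a (Suc n) * (w * of_real q) ^ Suc n
        = of_real (1 - q) * w * (a n * w ^ n)" for n
    proof -
      have p: "qfact q n > 0" by (rule qfact_pos[OF q])
      have d: "1 - q ^ Suc n > 0" using q by (simp add: power_Suc_less_one del: power_Suc)
      have "a (Suc n) * (1 - of_real q ^ Suc n) = of_real (1 / qfact q (Suc n) * (1 - q ^ Suc n))"
        by (simp add: a_def)
      also have "1 / qfact q (Suc n) * (1 - q ^ Suc n) = (1 - q) * (1 / qfact q n)"
        using p d q by (simp add: qfact_Suc field_simps del: power_Suc)
      finally have "a (Suc n) * (1 - of_real q ^ Suc n) = of_real (1 - q) * a n"
        by (simp add: a_def)
      then have "a (Suc n) * (1 - of_real q ^ Suc n) * w ^ Suc n = of_real (1 - q) * a n * w ^ Suc n"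
        by simp
      then show ?thesis by (simp add: algebra_simps power_mult_distrib)
    qed
    ultimately have "(\<lambda>n. of_real (1 - q) * w * (a n * w ^ n)) sums (G w - G (w * of_real q))"
      by simp
    moreover have "(\<lambda>n. of_real (1 - q) * w * (a n * w ^ n)) sums (of_real (1 - q) * w * G w)"
      unfolding G_def by (intro sums_mult summable_sums summ w)
    ultimately have "G w - G (w * of_real q) = of_real (1 - q) * w * G w"
      by (rule sums_unique2)
    then show ?thesis by (simp add: algebra_simps)
  qed
  let ?t = "\<lambda>k. 1 - of_real (1 - q) * z * of_real (q ^ k)"
  have iter: "(\<Prod>k<n. ?t k) * G z = G (z * of_real (q ^ n))" for n
  proof (induction n)
    case (Suc n)
    have "norm (z * of_real (q ^ n)) < 1 / (1 - q)"
      using small[of n] z by linarith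
    note st = step[OF this]
    have "(\<Prod>k<Suc n. ?t k) * G z = ?t n * ((\<Prod>k<n. ?t k) * G z)"
      by (simp only: prod.lessThan_Suc mult_ac)
    also have "\<dots> = (1 - of_real (1 - q) * (z * of_real (q ^ n))) * G (z * of_real (q ^ n))"
      by (subst Suc.IH) (simp only: mult.assoc)
    also have "\<dots> = G (z * of_real (q ^ Suc n))"
      by (subst st) (simp add: mult_ac)
    finally show ?case .
  qed simp
  have nz: "?t k \<noteq> 0" for k
  proof
    assume "?t k = 0"
    then have "norm (of_real (1 - q) * (z * of_real (q ^ k)) :: 'a) = 1"
      by (simp add: mult.assoc)
    then have "(1 - q) * norm (z * of_real (q ^ k)) = 1"
      using q by (subst (asm) norm_mult) (simp del: of_real_diff of_real_power)
    moreover have "(1 - q) * norm (z * of_real (q ^ k)) \<le> (1 - q) * norm z"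
      using small q by (intro mult_left_mono) auto
    moreover have "(1 - q) * norm z < 1" using q z by (simp add: pos_less_divide_eq mult.commute[of "1 - q"])
    ultimately show False by linarith
  qed
  have G0: "G 0 = 1"
    unfolding G_def by (subst powser_zero) (simp add: a_def qfact_def)
  have "isCont G 0"
  proof -
    let ?K = "of_real (1 / (2 * (1 - q))) :: 'a"
    have "norm ?K < 1 / (1 - q)"
      using q by (subst norm_of_real) (simp add: field_simps)
    then have "summable (\<lambda>n. a n * ?K ^ n)" by (rule summ)
    moreover have "norm (0::'a) < norm ?K"
      using q by (subst norm_of_real) simp
    ultimately show ?thesis unfolding G_def by (rule isCont_powser)
  qed
  moreover have "(\<lambda>n. z * of_real (q ^ n)) \<longlonglongrightarrow> z * of_real 0"
    using q by (intro tendsto_intros LIMSEQ_power_zero) auto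
  ultimately have lim: "(\<lambda>n. G (z * of_real (q ^ n))) \<longlonglongrightarrow> 1"
    using isCont_tendsto_compose[of 0 G "\<lambda>n. z * of_real (q ^ n)"] G0 by simp
  have Gz: "G z \<noteq> 0"
  proof
    assume "G z = 0"
    then have "G (z * of_real (q ^ n)) = 0" for n using iter[of n] by simp
    then show False using lim by (simp add: LIMSEQ_const_iff)
  qed
  have inv: "(\<Prod>k<n. inverse (?t k)) = G z * inverse (G (z * of_real (q ^ n)))" for n
    proof -
    have "(\<Prod>k<n. inverse (?t k)) = inverse (\<Prod>k<n. ?t k)"
      using prod_inversef[of ?t "{..<n}"] by (simp only: o_def)
    then show ?thesis
      unfolding iter[of n, symmetric] using Gz by (simp only: inverse_mult_distrib mult_ac) simp
  qed
  have "(\<lambda>n. G z * inverse (G (z * of_real (q ^ n)))) \<longlonglongrightarrow> G z * inverse 1"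
    by (intro tendsto_intros lim) auto
  then have "(\<lambda>n. \<Prod>k<n. inverse (?t k)) \<longlonglongrightarrow> G z"
    by (simp only: inv inverse_1 mult_1_right)
  then have "(\<lambda>n. \<Prod>k\<le>n. inverse (?t k)) \<longlonglongrightarrow> G z"
    unfolding lessThan_Suc_atMost[symmetric] by (rule LIMSEQ_Suc)
  then have "raw_has_prod (\<lambda>k. inverse (?t k)) 0 (G z)"
    using Gz by (simp add: raw_has_prod_def)
  then have "(\<lambda>k. inverse (?t k)) has_prod G z"
    by (simp add: has_prod_def)
  then have "qexp q z = G z"
    unfolding qexp_def by (rule has_prod_unique[symmetric])
  also have "\<dots> = (\<Sum>n. z ^ n / of_real (qfact q n))"
    unfolding G_def a_def by (simp add: field_simps)
  finally show ?thesis .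
qed

end

theory Submission
  imports Defs
begin

text \<open>
  The product formula gives \<open>e\<^sub>q(q z) = (1 - (1 - q) z) e\<^sub>q(z)\<close>, so that \<open>z = - r x\<close> yields
  \<open>x e\<^sub>q(-r x) = (e\<^sub>q(-q r x) - e\<^sub>q(-r x)) / ((1 - q) r)\<close>. Hence multiplying \<open>f\<close> by \<open>x\<close> turns the
  transform into minus its q-derivative in \<open>r\<close>, and convergence for \<open>f\<close> at \<open>r\<close> and \<open>q r\<close> gives
  convergence for \<open>x f\<close> at \<open>r\<close>.
\<close>

text \<open>The deviations of the factors from 1 form a geometric series. No pole has to be
  excluded: \<open>convergent_prod\<close> tolerates finitely many zero factors, and
  \<open>inverse 0 = 0\<close>.\<close>

lemma convergent_prod_qexp:
  fixes z :: "'a::{real_normed_field, banach}"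
  assumes q: "0 < q" "q < 1"
  shows "convergent_prod (\<lambda>k. inverse (1 - of_real (1 - q) * z * of_real (q ^ k)))"
proof -
  have "summable (\<lambda>k. norm (of_real (1 - q) * z) * q ^ k)"
    using q by (intro summable_mult summable_geometric) auto
  then have "summable (\<lambda>k. norm (1 - of_real (1 - q) * z * of_real (q ^ k) - 1))"
    using q by (simp add: norm_mult norm_power)
  then have "convergent_prod (\<lambda>k. 1 - of_real (1 - q) * z * of_real (q ^ k))"
    by (intro abs_convergent_prod_imp_convergent_prod summable_imp_abs_convergent_prod)
  then show ?thesis
    by (rule convergent_prod_inverse)
qed

lemma qexp_mult_q:
  fixes z :: "'a::{real_normed_field, banach}"
  assumes q: "0 < q" "q < 1" and nz: "of_real (1 - q) * z \<noteq> 1"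
  shows "qexp q (of_real q * z) = (1 - of_real (1 - q) * z) * qexp q z"
proof -
  let ?t = "\<lambda>k. 1 - of_real (1 - q) * z * of_real (q ^ k)"
  \<comment> \<open>Replacing \<open>z\<close> by \<open>q z\<close> shifts the index by one, so its
    product is the one for \<open>z\<close> without the head. The assumption \<open>nz\<close> keeps
    that head invertible.\<close>
  have "(\<Prod>k. inverse (?t (Suc k))) = (\<Prod>k. inverse (?t k)) / inverse (?t 0)"
    by (rule prodinf_split_head[OF convergent_prod_qexp[OF q]]) (use nz in simp)
  then show ?thesis
    unfolding qexp_def by (simp add: divide_inverse mult_ac)
qed

lemma mult_qexp_neg:
  assumes q: "0 < q" "q < 1" and "r > 0" "x \<ge> 0"
  shows "of_real x * qexp q (of_real (- r * x)) =
    of_real (1 / ((1 - q) * r)) *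
    (qexp q (of_real (- (q * r) * x)) - qexp q (of_real (- r * x)) :: 'a::{real_normed_field, banach})"
proof -
  let ?e = "qexp q (of_real (- r * x)) :: 'a"
  \<comment> \<open>The argument \<open>- r * x\<close> is nonpositive and hence avoids the pole at
    \<open>1 / (1 - q)\<close>.\<close>
  have "0 \<le> (1 - q) * (r * x)"
    using assms by auto
  then have "(1 - q) * (- r * x) \<noteq> 1"
    by simp
  then have nz: "of_real (1 - q) * of_real (- r * x) \<noteq> (1 :: 'a)"
    unfolding of_real_mult[symmetric] of_real_eq_1_iff .
  have "qexp q (of_real (- (q * r) * x)) = qexp q (of_real q * of_real (- r * x) :: 'a)"
    by (simp add: mult.assoc)
  also have "\<dots> = (1 - of_real (1 - q) * of_real (- r * x)) * ?e"
    by (rule qexp_mult_q[OF q nz])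
  also have "\<dots> = of_real ((1 - q) * r) * (of_real x * ?e) + ?e"
    by (simp add: algebra_simps)
  finally have "qexp q (of_real (- (q * r) * x)) - ?e = of_real ((1 - q) * r) * (of_real x * ?e)"
    by simp
  moreover have "of_real (1 / ((1 - q) * r)) * (of_real ((1 - q) * r) * u) = u" for u :: 'a
    unfolding mult.assoc[symmetric] of_real_mult[symmetric] using assms by simp
  ultimately show ?thesis
    by simp
qed

text \<open>Linearity of the absolutely convergent double series. The identity \<open>eq\<close> is
  asked for positive arguments only, since the series samples its integrand at powers of
  \<open>q\<close>.\<close>

lemma jackson2_diff:
  assumes q: "0 < q" and F: "jackson_integrable2 q F" and G: "jackson_integrable2 q G"
    and eq: "\<And>x y. x > 0 \<Longrightarrow> y > 0 \<Longrightarrow> H x y = c * (F x y - G x y)"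
  shows jackson_integrable2_diff: "jackson_integrable2 q H"
    and jackson_integral2_diff: "jackson_integral2 q H = c * (jackson_integral2 q F - jackson_integral2 q G)"
proof -
  define w where "w K = (\<lambda>(j::int, k::int). of_real (q powi j * q powi k) * K (q powi j) (q powi k))"
    for K :: "real \<Rightarrow> real \<Rightarrow> 'a"
  have wH: "w H = (\<lambda>p. c * (w F p - w G p))"
    using q by (auto simp: w_def eq fun_eq_iff algebra_simps)
  have abs: "w F abs_summable_on UNIV" "w G abs_summable_on UNIV"
    using F G unfolding jackson_integrable2_def w_def by auto
  have "(\<lambda>p. norm (w F p) + norm (w G p)) summable_on UNIV"
    by (rule summable_on_add[OF abs])
  then have "(\<lambda>p. w F p - w G p) abs_summable_on UNIV"
    by (rule Infinite_Sum.abs_summable_on_comparison_test') (rule norm_triangle_ineq4)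
  then have "w H abs_summable_on UNIV"
    unfolding wH norm_mult by (rule summable_on_cmult_right)
  then show "jackson_integrable2 q H"
    unfolding jackson_integrable2_def w_def .
  have "infsum (w H) UNIV = c * (infsum (w F) UNIV + infsum (\<lambda>p. - w G p) UNIV)"
    unfolding wH infsum_cmult_right' diff_conv_add_uminus using abs[THEN abs_summable_summable]
    by (subst infsum_add) (auto simp: summable_on_uminus)
  then show "jackson_integral2 q H = c * (jackson_integral2 q F - jackson_integral2 q G)"
    unfolding jackson_integral2_def w_def[symmetric] infsum_uminus
    by (simp add: right_diff_distrib mult.left_commute)
qed

lemma qlaplace2_mult_fst:
  assumes q: "0 < q" "q < 1" and r: "r > 0"
    and c: "qlaplace2_converges q f r s" "qlaplace2_converges q f (q * r) s"
  shows qlaplace2_converges_mult_fst: "qlaplace2_converges q (\<lambda>x y. of_real x * f x y) r s"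
    and qlaplace2_mult_fst_eq:
      "qlaplace2 q (\<lambda>x y. of_real x * f x y) r s = - qderiv_fst q (qlaplace2 q f) r s"
proof -
  have eq: "qlaplace2_integrand q (\<lambda>x y. of_real x * f x y) r s x y =
      of_real (1 / ((1 - q) * r)) *
      (qlaplace2_integrand q f (q * r) s x y - qlaplace2_integrand q f r s x y)"
    if "x > 0" for x y
    \<comment> \<open>The one-variable identity is multiplied by \<open>f x y\<close> and by the
      exponential in the other variable.\<close>
    using arg_cong[OF mult_qexp_neg[OF q r less_imp_le[OF that]],
        of "\<lambda>u. f x y * u * qexp q (of_real (- s * y))"]
    unfolding qlaplace2_integrand_def by (simp only: algebra_simps)
  note c' = c[unfolded qlaplace2_converges_def]
  show "qlaplace2_converges q (\<lambda>x y. of_real x * f x y) r s"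
    unfolding qlaplace2_converges_def by (rule jackson_integrable2_diff[OF q(1) c'(2,1) eq])
  \<comment> \<open>Here the value at \<open>q * r\<close> comes first, whereas
    \<open>qderiv_fst\<close> subtracts it; this is the source of the minus sign.\<close>
  show "qlaplace2 q (\<lambda>x y. of_real x * f x y) r s = - qderiv_fst q (qlaplace2 q f) r s"
    unfolding qlaplace2_def qderiv_fst_def
    by (subst jackson_integral2_diff[OF q(1) c'(2,1) eq]) (simp_all add: minus_divide_left)
qed

lemma qlaplace2_mult_snd:
  assumes q: "0 < q" "q < 1" and s: "s > 0"
    and c: "qlaplace2_converges q f r s" "qlaplace2_converges q f r (q * s)"
  shows qlaplace2_converges_mult_snd: "qlaplace2_converges q (\<lambda>x y. of_real y * f x y) r s"
    and qlaplace2_mult_snd_eq: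
      "qlaplace2 q (\<lambda>x y. of_real y * f x y) r s = - qderiv_snd q (qlaplace2 q f) r s"
proof -
  have eq: "qlaplace2_integrand q (\<lambda>x y. of_real y * f x y) r s x y =
      of_real (1 / ((1 - q) * s)) *
      (qlaplace2_integrand q f r (q * s) x y - qlaplace2_integrand q f r s x y)"
    if "y > 0" for x y
    using arg_cong[OF mult_qexp_neg[OF q s less_imp_le[OF that]],
        of "\<lambda>u. f x y * u * qexp q (of_real (- r * x))"]
    unfolding qlaplace2_integrand_def by (simp only: algebra_simps)
  note c' = c[unfolded qlaplace2_converges_def]
  show "qlaplace2_converges q (\<lambda>x y. of_real y * f x y) r s"
    unfolding qlaplace2_converges_def by (rule jackson_integrable2_diff[OF q(1) c'(2,1) eq])
  show "qlaplace2 q (\<lambda>x y. of_real y * f x y) r s = - qderiv_snd q (qlaplace2 q f) r s"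
    unfolding qlaplace2_def qderiv_snd_def
    by (subst jackson_integral2_diff[OF q(1) c'(2,1) eq]) (simp_all add: minus_divide_left)
qed

text \<open>Induction on \<open>m\<close> with \<open>r\<close> arbitrary: a q-derivative at
  \<open>r\<close> uses the previous stage at \<open>r\<close> and at \<open>q * r\<close>, and both
  orbits lie among the points assumed for \<open>Suc m\<close>. Convergence is proved alongside
  because the next multiplication by \<open>x\<close> requires it.\<close>

lemma qlaplace2_power_fst:
  assumes q: "0 < q" "q < 1" and "r > 0"
    and "\<And>i. i \<le> m \<Longrightarrow> qlaplace2_converges q f (q ^ i * r) s"
  shows "qlaplace2_converges q (\<lambda>x y. of_real (x ^ m) * f x y) r s \<and>
    qlaplace2 q (\<lambda>x y. of_real (x ^ m) * f x y) r s =
      (- 1) ^ m * (qderiv_fst q ^^ m) (qlaplace2 q f) r s"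
  using assms(3,4)
proof (induction m arbitrary: r)
  case 0
  then show ?case using 0(2)[of 0] by simp
next
  case (Suc m)
  have qr: "q * r > 0" using q Suc.prems by simp
  have "qlaplace2_converges q f (q ^ i * (q * r)) s" if "i \<le> m" for i
    using Suc.prems(2)[of "Suc i"] that by (simp add: mult_ac)
  note IH = Suc.IH[OF Suc.prems(1) Suc.prems(2)[OF le_SucI]] Suc.IH[OF qr this]
  let ?g = "\<lambda>x y. of_real (x ^ m) * f x y"
  have g: "qlaplace2_converges q ?g r s" "qlaplace2_converges q ?g (q * r) s"
    using IH by auto
  have xg: "(\<lambda>x y. of_real (x ^ Suc m) * f x y) = (\<lambda>x y. of_real x * ?g x y)"
    by (simp add: mult_ac)
  \<comment> \<open>Equality of the two functions at \<open>r\<close> and \<open>q * r\<close>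
    suffices, as the q-derivative reads no other values.\<close>
  have "qderiv_fst q (qlaplace2 q ?g) r s =
      (- 1) ^ m * (qderiv_fst q ^^ Suc m) (qlaplace2 q f) r s"
    using IH by (simp add: qderiv_fst_def[of q "qlaplace2 q _"]
        qderiv_fst_def[of q "(qderiv_fst q ^^ m) _"] right_diff_distrib)
  then show ?case
    unfolding xg using qlaplace2_mult_fst[OF q Suc.prems(1) g] by simp
qed

text \<open>
  The transform need only agree with \<open>G\<close> along the orbit \<open>s, q s, \<dots>, q\<^sup>n s\<close>, because the
  q-derivatives in \<open>r\<close> are identified with transforms at such points only.
\<close>

lemma qlaplace2_power_snd:
  assumes q: "0 < q" "q < 1" and "s > 0"
    and "\<And>j. j \<le> n \<Longrightarrow> qlaplace2_converges q f r (q ^ j * s)"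
    and "\<And>j. j \<le> n \<Longrightarrow> qlaplace2 q f r (q ^ j * s) = c * G r (q ^ j * s)"
  shows "qlaplace2_converges q (\<lambda>x y. of_real (y ^ n) * f x y) r s \<and>
    qlaplace2 q (\<lambda>x y. of_real (y ^ n) * f x y) r s =
      (- 1) ^ n * c * (qderiv_snd q ^^ n) G r s"
  using assms(3-5)
proof (induction n arbitrary: s)
  case 0
  then show ?case using 0(2,3)[of 0] by simp
next
  case (Suc n)
  have qs: "q * s > 0" using q Suc.prems by simp
  have "qlaplace2_converges q f r (q ^ j * (q * s))"
    and "qlaplace2 q f r (q ^ j * (q * s)) = c * G r (q ^ j * (q * s))" if "j \<le> n" for j
    using Suc.prems(2,3)[of "Suc j"] that by (simp_all add: mult_ac)
  note IH = Suc.IH[OF Suc.prems(1) Suc.prems(2)[OF le_SucI] Suc.prems(3)[OF le_SucI]]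
    Suc.IH[OF qs this]
  let ?g = "\<lambda>x y. of_real (y ^ n) * f x y"
  have g: "qlaplace2_converges q ?g r s" "qlaplace2_converges q ?g r (q * s)"
    using IH by auto
  have yg: "(\<lambda>x y. of_real (y ^ Suc n) * f x y) = (\<lambda>x y. of_real y * ?g x y)"
    by (simp add: mult_ac)
  \<comment> \<open>Only the values at \<open>s\<close> and \<open>q * s\<close> enter, and the
    constant factor \<open>c\<close> passes through the q-difference.\<close>
  have "qderiv_snd q (qlaplace2 q ?g) r s = (- 1) ^ n * c * (qderiv_snd q ^^ Suc n) G r s"
    using IH by (simp add: qderiv_snd_def[of q "qlaplace2 q _"]
        qderiv_snd_def[of q "(qderiv_snd q ^^ n) _"] right_diff_distrib)
  then show ?case
    unfolding yg using qlaplace2_mult_snd[OF q Suc.prems(1) g] by simp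
qed

theorem theorem4p9:
  fixes q r s :: real and m n :: nat
    and f :: "real \<Rightarrow> real \<Rightarrow> 'a::{real_normed_field, banach}"
  assumes "0 < q" and "q < 1" and "r > 0" and "s > 0"
    and "qlaplace2_converges q (\<lambda>x y. of_real (x ^ m * y ^ n) * f x y) r s"
    and "\<And>i j. i \<le> m \<Longrightarrow> j \<le> n \<Longrightarrow> qlaplace2_converges q f (q ^ i * r) (q ^ j * s)"
  shows "qlaplace2 q (\<lambda>x y. of_real (x ^ m * y ^ n) * f x y) r s =
    (- 1) ^ (m + n) * (qderiv_snd q ^^ n) ((qderiv_fst q ^^ m) (qlaplace2 q f)) r s"
proof -
  let ?g = "\<lambda>x y. of_real (x ^ m) * f x y"
  \<comment> \<open>The powers of \<open>x\<close> are treated first, separately for each point of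
    the orbit of \<open>s\<close>.\<close>
  have "qlaplace2_converges q ?g r (q ^ j * s)"
    and "qlaplace2 q ?g r (q ^ j * s) =
      (- 1) ^ m * (qderiv_fst q ^^ m) (qlaplace2 q f) r (q ^ j * s)" if "j \<le> n" for j
    using qlaplace2_power_fst[OF assms(1-3) assms(6)[OF _ that]] by blast+
  \<comment> \<open>Now \<open>c\<close> is the sign \<open>(- 1) ^ m\<close> and \<open>G\<close>
    is the iterated q-derivative in \<open>r\<close>.\<close>
  then have "qlaplace2 q (\<lambda>x y. of_real (y ^ n) * ?g x y) r s =
      (- 1) ^ n * (- 1) ^ m * (qderiv_snd q ^^ n) ((qderiv_fst q ^^ m) (qlaplace2 q f)) r s"
    using qlaplace2_power_snd[OF assms(1,2,4)] by blast
  then show ?thesis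
    by (simp add: power_add mult_ac)
qed

end
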